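(* Let $I$ be a (small) set, let $(\mathcal A_i)_{i\in I}$ be a family of nonempty categories, and for each $i\in I$ let $S_i\subseteq\mathsf{Mor}(\mathcal A_i)$ be a class of morphisms containing all identity morphisms of $\mathcal A_i$. Let $$\Theta:\Big(\prod_{i\in I}\mathcal A_i\Big)\Big[\Big(\prod_{i\in I}S_i\Big)^{-1}\Big]\longrightarrow\prod_{i\in I}\mathcal A_i[S_i^{-1}]$$ be the canonical functor induced by the universal property of localization. Then $\Theta$ is full if and only if there exist a finite subset $F\subseteq I$ and $N\in\mathbb N$ such that $\ell(\mathfrak P)\leq N$ for every $i\in I\setminus F$ and every $\mathfrak P\in\langle\mathsf{Mor}(\mathcal A_i)\sqcup\overline{S_i}\rangle$.
   Context: Size issues are ignored (or handled by universes); localizations always exist. For a category $\mathcal A$ and a class $S\subseteq\mathsf{Mor}(\mathcal A)$, the Gabriel--Zisman localization $Q:\mathcal A\to\mathcal A[S^{-1}]$ sends every morphism of $S$ to an isomorphism, and every functor out of $\mathcal A$ sending $S$ to isomorphisms factors uniquely (on the nose) through $Q$. Explicit model. Regard the morphisms of $\mathcal A$ as mere arrows with source and target. Let $\overline S=\{\overline s:Y\to X\mid (s:X\to Y)\in S\}$ be a class of new formal arrows. $\langle\mathsf{Mor}(\mathcal A)\sqcup\overline S\rangle$ is the class of all finite formal compositions (nonempty words $a_m\ast\cdots\ast a_1$ of composable arrows) of arrows in the disjoint union $\mathsf{Mor}(\mathcal A)\sqcup\overline S$; $\ast$ denotes formal composition. For such a word $\mathfrak P$, $|\mathfrak P|$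 is its number of arrows. Consider the equivalence relation generated by: $g\circ f\sim g\ast f$ for composable $f,g\in\mathsf{Mor}(\mathcal A)$; $\operatorname{Id}_N\ast a\sim a\sim a\ast\operatorname{Id}_M$ for every arrow $a:M\to N$ in $\mathsf{Mor}(\mathcal A)\sqcup\overline S$; $s\ast\overline s\sim\operatorname{Id}_Y$ and $\overline s\ast s\sim\operatorname{Id}_X$ for $s:X\to Y$ in $S$; and closure under formal composition on either side. Then $\mathcal A[S^{-1}]$ has the objects of $\mathcal A$, its morphisms $X\to Y$ are the equivalence classes $[\mathfrak P]$ of words from $X$ to $Y$, and composition is induced by $\ast$. Define $\ell(\mathfrak P)=\min\{|\mathfrak P'| : [\mathfrak P']=[\mathfrak P]\}$, where $\mathfrak P'$ ranges over $\langle\mathsf{Mor}(\mathcal A)\sqcup\overline S\rangle$. The class $\prod_{i\in I}S_i$ consists of the morphisms $(s_i)_{i\in I}$ of $\prod_{i\in I}\mathcal A_i$ with $s_i\in S_i$ for all $i$. If $Q_i:\mathcal A_i\to\mathcal A_i[S_i^{-1}]$ are the localizations, $\Theta$ is the unique functor whose composite with the localization functor of $\prod_i\mathcal A_i$ at $\prod_i S_i$ equals $\prod_{i}Q_i$. *)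

theory Defs
  imports "HOL-Library.FuncSet"
begin

section \<open>Categories and functors\<close>

record ('o, 'm) category =
  Obj :: "'o set"
  Arr :: "'m set"
  src :: "'m \<Rightarrow> 'o"
  tgt :: "'m \<Rightarrow> 'o"
  ident :: "'o \<Rightarrow> 'm"
  cmp :: "'m \<Rightarrow> 'm \<Rightarrow> 'm"

text \<open>\<open>cmp A g f\<close> is the composite "g after f"; it is meaningful only when \<open>src A g = tgt A f\<close>.\<close>

locale category =
  fixes A :: "('o, 'm) category"
  assumes src_Obj: "f \<in> Arr A \<Longrightarrow> src A f \<in> Obj A"
    and tgt_Obj: "f \<in> Arr A \<Longrightarrow> tgt A f \<in> Obj A"
    and ident_Arr: "X \<in> Obj A \<Longrightarrow> ident A X \<in> Arr A"
    and src_ident: "X \<in> Obj A \<Longrightarrow> src A (ident A X) = X"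
    and tgt_ident: "X \<in> Obj A \<Longrightarrow> tgt A (ident A X) = X"
    and cmp_Arr: "\<lbrakk>g \<in> Arr A; f \<in> Arr A; src A g = tgt A f\<rbrakk> \<Longrightarrow> cmp A g f \<in> Arr A"
    and src_cmp: "\<lbrakk>g \<in> Arr A; f \<in> Arr A; src A g = tgt A f\<rbrakk> \<Longrightarrow> src A (cmp A g f) = src A f"
    and tgt_cmp: "\<lbrakk>g \<in> Arr A; f \<in> Arr A; src A g = tgt A f\<rbrakk> \<Longrightarrow> tgt A (cmp A g f) = tgt A g"
    and ident_left: "f \<in> Arr A \<Longrightarrow> cmp A (ident A (tgt A f)) f = f"
    and ident_right: "f \<in> Arr A \<Longrightarrow> cmp A f (ident A (src A f)) = f"
    and cmp_assoc: "\<lbrakk>h \<in> Arr A; g \<in> Arr A; f \<in> Arr A; src A h = tgt A g; src A g = tgt A f\<rbrakk>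
      \<Longrightarrow> cmp A (cmp A h g) f = cmp A h (cmp A g f)"

definition isomorphism :: "('o, 'm) category \<Rightarrow> 'm \<Rightarrow> bool" where
  "isomorphism A f \<longleftrightarrow> f \<in> Arr A \<and>
    (\<exists>g\<in>Arr A. src A g = tgt A f \<and> tgt A g = src A f \<and>
      cmp A g f = ident A (src A f) \<and> cmp A f g = ident A (tgt A f))"

record ('o1, 'm1, 'o2, 'm2) functor_data =
  on_obj :: "'o1 \<Rightarrow> 'o2"
  on_arr :: "'m1 \<Rightarrow> 'm2"

text \<open>Functors are extensional, so that functors with the same domain are equal as soon as they
  agree on its objects and arrows.\<close>

definition is_functor ::
  "('o1, 'm1) category \<Rightarrow> ('o2, 'm2) category \<Rightarrow> ('o1, 'm1, 'o2, 'm2) functor_data \<Rightarrow> bool" where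
  "is_functor A B F \<longleftrightarrow>
    on_obj F \<in> Obj A \<rightarrow>\<^sub>E Obj B \<and> on_arr F \<in> Arr A \<rightarrow>\<^sub>E Arr B \<and>
    (\<forall>f\<in>Arr A. src B (on_arr F f) = on_obj F (src A f) \<and> tgt B (on_arr F f) = on_obj F (tgt A f)) \<and>
    (\<forall>X\<in>Obj A. on_arr F (ident A X) = ident B (on_obj F X)) \<and>
    (\<forall>g\<in>Arr A. \<forall>f\<in>Arr A. src A g = tgt A f \<longrightarrow>
      on_arr F (cmp A g f) = cmp B (on_arr F g) (on_arr F f))"

definition functor_comp ::
  "('o1, 'm1) category \<Rightarrow> ('o2, 'm2, 'o3, 'm3) functor_data \<Rightarrow> ('o1, 'm1, 'o2, 'm2) functor_data
    \<Rightarrow> ('o1, 'm1, 'o3, 'm3) functor_data" where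
  "functor_comp A G F = \<lparr>on_obj = compose (Obj A) (on_obj G) (on_obj F),
    on_arr = compose (Arr A) (on_arr G) (on_arr F)\<rparr>"

definition full_functor ::
  "('o1, 'm1) category \<Rightarrow> ('o2, 'm2) category \<Rightarrow> ('o1, 'm1, 'o2, 'm2) functor_data \<Rightarrow> bool" where
  "full_functor A B F \<longleftrightarrow>
    (\<forall>X\<in>Obj A. \<forall>Y\<in>Obj A. \<forall>g\<in>Arr B. src B g = on_obj F X \<and> tgt B g = on_obj F Y \<longrightarrow>
      (\<exists>f\<in>Arr A. src A f = X \<and> tgt A f = Y \<and> on_arr F f = g))"

section \<open>Products\<close>

definition product_category :: "'i set \<Rightarrow> ('i \<Rightarrow> ('o, 'm) category) \<Rightarrow> ('i \<Rightarrow> 'o, 'i \<Rightarrow> 'm) category" where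
  "product_category I A = \<lparr>
    Obj = (\<Pi>\<^sub>E i\<in>I. Obj (A i)),
    Arr = (\<Pi>\<^sub>E i\<in>I. Arr (A i)),
    src = (\<lambda>f. \<lambda>i\<in>I. src (A i) (f i)),
    tgt = (\<lambda>f. \<lambda>i\<in>I. tgt (A i) (f i)),
    ident = (\<lambda>X. \<lambda>i\<in>I. ident (A i) (X i)),
    cmp = (\<lambda>g f. \<lambda>i\<in>I. cmp (A i) (g i) (f i))\<rparr>"

definition product_functor ::
  "'i set \<Rightarrow> ('i \<Rightarrow> ('o1, 'm1) category) \<Rightarrow> ('i \<Rightarrow> ('o1, 'm1, 'o2, 'm2) functor_data)
    \<Rightarrow> ('i \<Rightarrow> 'o1, 'i \<Rightarrow> 'm1, 'i \<Rightarrow> 'o2, 'i \<Rightarrow> 'm2) functor_data" where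
  "product_functor I A F = \<lparr>
    on_obj = (\<lambda>X\<in>Obj (product_category I A). \<lambda>i\<in>I. on_obj (F i) (X i)),
    on_arr = (\<lambda>f\<in>Arr (product_category I A). \<lambda>i\<in>I. on_arr (F i) (f i))\<rparr>"

section \<open>Gabriel--Zisman localization\<close>

text \<open>\<open>Formal s\<close> is the formal arrow from the target of \<open>s\<close> to its source.\<close>

datatype 'm arrow = Orig 'm | Formal 'm

fun arrow_src :: "('o, 'm) category \<Rightarrow> 'm arrow \<Rightarrow> 'o" where
  "arrow_src A (Orig f) = src A f"
| "arrow_src A (Formal s) = tgt A s"

fun arrow_tgt :: "('o, 'm) category \<Rightarrow> 'm arrow \<Rightarrow> 'o" where
  "arrow_tgt A (Orig f) = tgt A f"
| "arrow_tgt A (Formal s) = src A s"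

definition arrows :: "('o, 'm) category \<Rightarrow> 'm set \<Rightarrow> 'm arrow set" where
  "arrows A S = Orig ` Arr A \<union> Formal ` S"

text \<open>The word \<open>a\<^sub>m * \<dots> * a\<^sub>1\<close> is the list \<open>[a\<^sub>m, \<dots>, a\<^sub>1]\<close>: formal composition is \<open>@\<close>, the
  last element of the list is the first arrow to be applied.\<close>

definition words :: "('o, 'm) category \<Rightarrow> 'm set \<Rightarrow> 'm arrow list set" where
  "words A S = {w. w \<noteq> [] \<and> set w \<subseteq> arrows A S \<and>
    successively (\<lambda>b a. arrow_src A b = arrow_tgt A a) w}"

definition word_src :: "('o, 'm) category \<Rightarrow> 'm arrow list \<Rightarrow> 'o" where
  "word_src A w = arrow_src A (last w)"

definition word_tgt :: "('o, 'm) category \<Rightarrow> 'm arrow list \<Rightarrow> 'o" where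
  "word_tgt A w = arrow_tgt A (hd w)"

inductive word_equiv ::
  "('o, 'm) category \<Rightarrow> 'm set \<Rightarrow> 'm arrow list \<Rightarrow> 'm arrow list \<Rightarrow> bool"
  for A S where
  comp: "\<lbrakk>g \<in> Arr A; f \<in> Arr A; src A g = tgt A f\<rbrakk>
    \<Longrightarrow> word_equiv A S [Orig (cmp A g f)] [Orig g, Orig f]"
| id_left: "a \<in> arrows A S \<Longrightarrow> word_equiv A S [Orig (ident A (arrow_tgt A a)), a] [a]"
| id_right: "a \<in> arrows A S \<Longrightarrow> word_equiv A S [a, Orig (ident A (arrow_src A a))] [a]"
| inv_right: "s \<in> S \<Longrightarrow> word_equiv A S [Orig s, Formal s] [Orig (ident A (tgt A s))]"
| inv_left: "s \<in> S \<Longrightarrow> word_equiv A S [Formal s, Orig s] [Orig (ident A (src A s))]"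
| refl: "w \<in> words A S \<Longrightarrow> word_equiv A S w w"
| sym: "word_equiv A S v w \<Longrightarrow> word_equiv A S w v"
| trans: "\<lbrakk>word_equiv A S u v; word_equiv A S v w\<rbrakk> \<Longrightarrow> word_equiv A S u w"
| cong_left: "\<lbrakk>word_equiv A S v w; u \<in> words A S; word_src A u = word_tgt A v\<rbrakk>
    \<Longrightarrow> word_equiv A S (u @ v) (u @ w)"
| cong_right: "\<lbrakk>word_equiv A S v w; u \<in> words A S; word_src A v = word_tgt A u\<rbrakk>
    \<Longrightarrow> word_equiv A S (v @ u) (w @ u)"

definition word_rel :: "('o, 'm) category \<Rightarrow> 'm set \<Rightarrow> ('m arrow list \<times> 'm arrow list) set" where
  "word_rel A S = {(v, w). word_equiv A S v w}"

definition word_class :: "('o, 'm) category \<Rightarrow> 'm set \<Rightarrow> 'm arrow list \<Rightarrow> 'm arrow list set" where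
  "word_class A S w = word_rel A S `` {w}"

text \<open>\<open>word_equiv\<close> relates only words with the same source and the same target, so \<open>the_elem\<close> reads
  them off a class; the union in \<open>cmp\<close> is over all representatives and yields the single class
  of the concatenation.\<close>

definition localization ::
  "('o, 'm) category \<Rightarrow> 'm set \<Rightarrow> ('o, 'm arrow list set) category" where
  "localization A S = \<lparr>
    Obj = Obj A,
    Arr = words A S // word_rel A S,
    src = (\<lambda>c. the_elem (word_src A ` c)),
    tgt = (\<lambda>c. the_elem (word_tgt A ` c)),
    ident = (\<lambda>X. word_class A S [Orig (ident A X)]),
    cmp = (\<lambda>d c. \<Union>w\<in>d. \<Union>v\<in>c. word_class A S (w @ v))\<rparr>"

definition localization_functor ::
  "('o, 'm) category \<Rightarrow> 'm set \<Rightarrow> ('o, 'm, 'o, 'm arrow list set) functor_data" where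
  "localization_functor A S = \<lparr>
    on_obj = (\<lambda>X\<in>Obj A. X),
    on_arr = (\<lambda>f\<in>Arr A. word_class A S [Orig f])\<rparr>"

definition word_length :: "('o, 'm) category \<Rightarrow> 'm set \<Rightarrow> 'm arrow list \<Rightarrow> nat" where
  "word_length A S w =
    (LEAST n. \<exists>v\<in>words A S. word_class A S v = word_class A S w \<and> length v = n)"

section \<open>The canonical functor\<close>

definition canonical_functor ::
  "'i set \<Rightarrow> ('i \<Rightarrow> ('o, 'm) category) \<Rightarrow> ('i \<Rightarrow> 'm set)
    \<Rightarrow> ('i \<Rightarrow> 'o, ('i \<Rightarrow> 'm) arrow list set, 'i \<Rightarrow> 'o, 'i \<Rightarrow> 'm arrow list set) functor_data" where
  "canonical_functor I A S = (THE \<Theta>.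
    is_functor (localization (product_category I A) (Pi\<^sub>E I S))
      (product_category I (\<lambda>i. localization (A i) (S i))) \<Theta> \<and>
    functor_comp (product_category I A) \<Theta>
      (localization_functor (product_category I A) (Pi\<^sub>E I S)) =
    product_functor I A (\<lambda>i. localization_functor (A i) (S i)))"

end

theory Submission
  imports Defs
begin

text \<open>
  A word over the product category projects, letter by letter, to a word of the same length over each
  factor. The canonical functor sends the class of a word to the family of classes of its
  projections (\<open>canonical_functor_componentwise\<close>): this is well defined because each
  generating relation of the product projects to one of the factor, and it is the canonical functor
  because a functor out of a localization is determined by its restriction along the localization
  functor (\<open>functor_from_localization_unique\<close>). Fullness then says that every family of words,
  one over each factor, is up to equivalence the family of projections of a single word over the
  product (\<open>full_iff_lift_words\<close>). The source and the target of the lift take care of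
  themselves, since equivalent words are parallel.

  If a lift \<open>v\<close> of a family exists, then \<open>length v\<close> bounds the word lengths of all its
  members. When no finite set of indices can be removed to make the lengths uniformly bounded,
  infinitely many factors have words of length above \<open>n\<close>, for every \<open>n\<close>; one can choose
  distinct factors \<open>\<iota> 0, \<iota> 1, \<dots>\<close> where the \<open>n\<close>-th one carries a word of length
  above \<open>n\<close>. A family that contains all these words has no lift
  (\<open>lengths_bounded_if_lift_words\<close>).

  Conversely, a family of words of bounded length has representatives that all have the same shape
  \<open>Orig, Formal, Orig, Formal, \<dots>\<close> and the same length, because identities can be inserted
  both as original and as formal letters (\<open>word_zigzag_of_length\<close>); this is where the
  identities in \<open>S i\<close> enter. Words of one shape are tupled position by position to a word over
  the product (\<open>lift_words_of_bounded_length\<close>). Finitely many factors without a bound do no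
  harm: a given family has only one word over each of them.
\<close>

section \<open>Words and their classes\<close>

locale localizing = category A for A :: "('o, 'm) category" +
  fixes S :: "'m set"
  assumes S_Arr: "S \<subseteq> Arr A"
begin

abbreviation L :: "('o, 'm arrow list set) category" where
  "L \<equiv> localization A S"

lemma arrow_src_Obj: "a \<in> arrows A S \<Longrightarrow> arrow_src A a \<in> Obj A"
  and arrow_tgt_Obj: "a \<in> arrows A S \<Longrightarrow> arrow_tgt A a \<in> Obj A"
  using S_Arr by (auto simp: arrows_def src_Obj tgt_Obj)

lemma Orig_arrow [simp]: "Orig f \<in> arrows A S \<longleftrightarrow> f \<in> Arr A"
  and Formal_arrow [simp]: "Formal s \<in> arrows A S \<longleftrightarrow> s \<in> S"
  by (auto simp: arrows_def)

lemma singleton_words [simp]: "[a] \<in> words A S \<longleftrightarrow> a \<in> arrows A S"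
  and pair_words [simp]: "[b, a] \<in> words A S \<longleftrightarrow>
    b \<in> arrows A S \<and> a \<in> arrows A S \<and> arrow_src A b = arrow_tgt A a"
  by (auto simp: words_def)

lemma append_words:
  assumes "v \<in> words A S" "w \<in> words A S" "word_src A v = word_tgt A w"
  shows "v @ w \<in> words A S"
  using assms by (auto simp: words_def word_src_def word_tgt_def successively_append_iff)

lemma Cons_words:
  assumes "w \<noteq> []"
  shows "a # w \<in> words A S \<longleftrightarrow>
    a \<in> arrows A S \<and> w \<in> words A S \<and> arrow_src A a = word_tgt A w"
  using assms by (cases w) (auto simp: words_def word_tgt_def)

lemma words_nonempty: "w \<in> words A S \<Longrightarrow> w \<noteq> []"
  by (simp add: words_def)

lemma word_src_append: "w \<noteq> [] \<Longrightarrow> word_src A (v @ w) = word_src A w"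
  and word_tgt_append: "v \<noteq> [] \<Longrightarrow> word_tgt A (v @ w) = word_tgt A v"
  by (auto simp: word_src_def word_tgt_def)

lemma word_src_singleton [simp]: "word_src A [a] = arrow_src A a"
  and word_tgt_Cons [simp]: "word_tgt A (a # w) = arrow_tgt A a"
  by (auto simp: word_src_def word_tgt_def)

lemma word_src_Obj: "w \<in> words A S \<Longrightarrow> word_src A w \<in> Obj A"
  and word_tgt_Obj: "w \<in> words A S \<Longrightarrow> word_tgt A w \<in> Obj A"
  by (auto simp: words_def word_src_def word_tgt_def intro!: arrow_src_Obj arrow_tgt_Obj)

text \<open>
  By induction over the generating relations. This is what makes source and target of a class,
  and thereby composition of classes, well defined.
\<close>

lemma word_equiv_parallel:
  assumes "word_equiv A S v w"
  shows "v \<in> words A S \<and> w \<in> words A S \<and> word_src A v = word_src A w \<and> word_tgt A v = word_tgt A w"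
  using assms
proof induction
  case (comp g f)
  then show ?case
    by (auto simp: word_src_def cmp_Arr src_cmp tgt_cmp)
next
  case (id_left a)
  then show ?case
    by (auto simp: word_src_def arrow_tgt_Obj ident_Arr src_ident tgt_ident)
next
  case (id_right a)
  then show ?case
    by (auto simp: word_src_def arrow_src_Obj ident_Arr src_ident tgt_ident)
next
  case (inv_right s)
  then have "s \<in> Arr A" using S_Arr by blast
  with inv_right show ?case
    by (auto simp: word_src_def tgt_Obj ident_Arr src_ident tgt_ident)
next
  case (inv_left s)
  then have "s \<in> Arr A" using S_Arr by blast
  with inv_left show ?case
    by (auto simp: word_src_def src_Obj ident_Arr src_ident tgt_ident)
next
  case (cong_left v w u)
  then show ?case
    by (auto simp: append_words word_src_append word_tgt_append words_nonempty)
next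
  case (cong_right v w u)
  then show ?case
    by (auto simp: append_words word_src_append word_tgt_append words_nonempty)
qed auto

lemma word_equiv_append:
  assumes "word_equiv A S v v'" "word_equiv A S w w'" "word_src A v = word_tgt A w"
  shows "word_equiv A S (v @ w) (v' @ w')"
proof -
  have "word_equiv A S (v @ w) (v' @ w)"
    using assms word_equiv_parallel by (metis word_equiv.cong_right)
  moreover have "word_equiv A S (v' @ w) (v' @ w')"
    using assms word_equiv_parallel by (metis word_equiv.cong_left)
  ultimately show ?thesis by (rule word_equiv.trans)
qed

lemma mem_word_class: "v \<in> word_class A S w \<longleftrightarrow> word_equiv A S w v"
  by (simp add: word_class_def word_rel_def)

lemma word_class_eq_iff:
  assumes "v \<in> words A S"
  shows "word_class A S v = word_class A S w \<longleftrightarrow> word_equiv A S v w"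
proof
  assume "word_class A S v = word_class A S w"
  then show "word_equiv A S v w"
    using assms by (metis mem_word_class word_equiv.refl word_equiv.sym)
next
  assume "word_equiv A S v w"
  then show "word_class A S v = word_class A S w"
    by (auto simp: mem_word_class) (metis word_equiv.trans word_equiv.sym)+
qed

lemma word_length_le:
  assumes "word_equiv A S v w"
  shows "word_length A S w \<le> length v"
  unfolding word_length_def
  by (rule Least_le) (use assms word_equiv_parallel word_class_eq_iff in blast)

lemma ex_word_of_word_length:
  assumes "w \<in> words A S"
  shows "\<exists>v. word_equiv A S v w \<and> length v = word_length A S w"
proof -
  have "\<exists>n. \<exists>v\<in>words A S. word_class A S v = word_class A S w \<and> length v = n"
    using assms by blast
  then have "\<exists>v\<in>words A S. word_class A S v = word_class A S w \<and> length v = word_length A S w"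
    unfolding word_length_def by (rule LeastI_ex)
  then show ?thesis using word_class_eq_iff by blast
qed

section \<open>The localization as a category\<close>

lemma Obj_L [simp]: "Obj L = Obj A"
  by (simp add: localization_def)

lemma ident_L: "ident L X = word_class A S [Orig (ident A X)]"
  by (simp add: localization_def)

lemma Arr_L: "Arr L = word_class A S ` words A S"
  by (auto simp: localization_def quotient_def word_class_def)

lemma src_L: "w \<in> words A S \<Longrightarrow> src L (word_class A S w) = word_src A w"
  and tgt_L: "w \<in> words A S \<Longrightarrow> tgt L (word_class A S w) = word_tgt A w"
proof -
  assume "w \<in> words A S"
  then have w: "w \<in> word_class A S w" by (simp add: mem_word_class word_equiv.refl)
  have v: "word_src A v = word_src A w" "word_tgt A v = word_tgt A w" if "v \<in> word_class A S w" for v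
    using word_equiv_parallel[of w v] that by (simp_all add: mem_word_class)
  have "word_src A ` word_class A S w = {word_src A w}" "word_tgt A ` word_class A S w = {word_tgt A w}"
    using w v by blast+
  then show "src L (word_class A S w) = word_src A w" "tgt L (word_class A S w) = word_tgt A w"
    by (simp_all add: localization_def)
qed

lemma cmp_L:
  assumes "v \<in> words A S" "w \<in> words A S" "word_src A v = word_tgt A w"
  shows "cmp L (word_class A S v) (word_class A S w) = word_class A S (v @ w)"
proof -
  let ?V = "word_class A S v" and ?W = "word_class A S w"
  have "word_class A S (v' @ w') = word_class A S (v @ w)" if "v' \<in> ?V" "w' \<in> ?W" for v' w'
    using that assms append_words word_equiv_append word_class_eq_iff mem_word_class by metis
  then have "(\<Union>v'\<in>?V. \<Union>w'\<in>?W. word_class A S (v' @ w')) = (\<Union>v'\<in>?V. \<Union>w'\<in>?W. word_class A S (v @ w))"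
    by simp
  moreover have "v \<in> ?V" "w \<in> ?W"
    using assms by (auto simp: mem_word_class intro: word_equiv.refl)
  then have "?V \<noteq> {}" "?W \<noteq> {}" by blast+
  ultimately show ?thesis by (simp add: localization_def)
qed

text \<open>
  The relations provide unit laws for single letters; a longer word is split at its first letter,
  the rest being carried along by congruence. The law on the right is symmetric.
\<close>

lemma ident_word_left:
  assumes "w \<in> words A S"
  shows "word_equiv A S (Orig (ident A (word_tgt A w)) # w) w"
proof (cases "tl w = []")
  case True
  then obtain a where "w = [a]" using words_nonempty[OF assms] by (cases w) auto
  with assms show ?thesis by (auto intro: word_equiv.id_left)
next
  case False
  then obtain a u where w: "w = a # u" "u \<noteq> []" by (cases w) auto
  with assms have a: "a \<in> arrows A S" "u \<in> words A S" "arrow_src A a = word_tgt A u"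
    by (auto simp: Cons_words)
  have "word_equiv A S ([Orig (ident A (arrow_tgt A a)), a] @ u) ([a] @ u)"
    using a by (intro word_equiv_append word_equiv.id_left word_equiv.refl)
      (auto simp: word_src_def)
  with w show ?thesis by simp
qed

lemma ident_word_right:
  assumes "w \<in> words A S"
  shows "word_equiv A S (w @ [Orig (ident A (word_src A w))]) w"
proof (cases "butlast w = []")
  case True
  then obtain a where "w = [a]" using words_nonempty[OF assms]
    by (metis append_butlast_last_id append_Nil)
  with assms show ?thesis by (auto intro: word_equiv.id_right)
next
  case False
  define u a where "u = butlast w" and "a = last w"
  have w: "w = u @ [a]" "u \<noteq> []"
    using False words_nonempty[OF assms] by (auto simp: u_def a_def)
  with assms have a: "a \<in> arrows A S" "u \<in> words A S" "word_src A u = arrow_tgt A a"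
    by (auto simp: words_def word_src_def successively_append_iff)
  have "word_equiv A S (u @ [a, Orig (ident A (arrow_src A a))]) (u @ [a])"
    using a by (intro word_equiv_append word_equiv.id_right word_equiv.refl) auto
  with w show ?thesis by (simp add: word_src_def)
qed

lemma category_L: "category L"
proof
  fix f assume "f \<in> Arr L"
  then obtain w where w: "f = word_class A S w" "w \<in> words A S" by (auto simp: Arr_L)
  then show "src L f \<in> Obj L" "tgt L f \<in> Obj L"
    by (auto simp: src_L tgt_L word_src_Obj word_tgt_Obj)
  show "cmp L (ident L (tgt L f)) f = f"
    using w by (simp add: tgt_L ident_L cmp_L word_tgt_Obj ident_Arr src_ident
        word_class_eq_iff Cons_words words_nonempty ident_word_left)
  have "w @ [Orig (ident A (word_src A w))] \<in> words A S"
    using w by (blast dest: ident_word_right word_equiv_parallel)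
  then show "cmp L f (ident L (src L f)) = f"
    using w by (simp add: src_L ident_L cmp_L word_src_Obj ident_Arr tgt_ident
        word_class_eq_iff ident_word_right)
next
  fix X assume "X \<in> Obj L"
  then show "ident L X \<in> Arr L" "src L (ident L X) = X" "tgt L (ident L X) = X"
    by (auto simp: ident_L Arr_L src_L tgt_L ident_Arr src_ident tgt_ident)
next
  fix g f assume "g \<in> Arr L" "f \<in> Arr L" "src L g = tgt L f"
  then obtain v w where "g = word_class A S v" "f = word_class A S w"
    "v \<in> words A S" "w \<in> words A S" "word_src A v = word_tgt A w"
    by (auto simp: Arr_L src_L tgt_L)
  then show "cmp L g f \<in> Arr L" "src L (cmp L g f) = src L f" "tgt L (cmp L g f) = tgt L g"
    by (auto simp: Arr_L cmp_L src_L tgt_L append_words word_src_append word_tgt_append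
        words_nonempty)
next
  fix h g f
  assume "h \<in> Arr L" "g \<in> Arr L" "f \<in> Arr L" "src L h = tgt L g" "src L g = tgt L f"
  moreover from this obtain u v w where w: "h = word_class A S u" "g = word_class A S v"
    "f = word_class A S w" "u \<in> words A S" "v \<in> words A S" "w \<in> words A S"
    unfolding Arr_L by blast
  ultimately have "word_src A u = word_tgt A v" "word_src A v = word_tgt A w"
    by (simp_all add: src_L tgt_L)
  with w show "cmp L (cmp L h g) f = cmp L h (cmp L g f)"
    by (simp add: cmp_L append_words word_src_append word_tgt_append words_nonempty)
qed

lemma cmp_L_inverse:
  assumes "s \<in> S"
  shows "cmp L (word_class A S [Formal s]) (word_class A S [Orig s]) = ident L (src A s)"
    and "cmp L (word_class A S [Orig s]) (word_class A S [Formal s]) = ident L (tgt A s)"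
proof -
  have s: "s \<in> Arr A" using assms S_Arr by blast
  show "cmp L (word_class A S [Formal s]) (word_class A S [Orig s]) = ident L (src A s)"
    and "cmp L (word_class A S [Orig s]) (word_class A S [Formal s]) = ident L (tgt A s)"
    using assms s
    by (simp_all add: cmp_L ident_L word_class_eq_iff word_equiv.inv_left word_equiv.inv_right)
qed

text \<open>
  Every class is a composite of classes of single letters. A functor is prescribed on the letters
  \<open>Orig f\<close>, and it sends \<open>Formal s\<close> to the inverse of its value on \<open>Orig s\<close>; inverses in a
  category are unique.
\<close>

lemma functor_from_localization_unique:
  assumes B: "category B"
    and F: "is_functor L B F" and G: "is_functor L B G"
    and eq: "functor_comp A F (localization_functor A S) = functor_comp A G (localization_functor A S)"
  shows "F = G"
proof -
  interpret B: category B by (rule B)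
  have obj: "on_obj F X = on_obj G X" if "X \<in> Obj A" for X
    using fun_cong[OF arg_cong[OF eq, of on_obj], of X] that
    by (simp add: functor_comp_def localization_functor_def compose_def)
  have orig: "on_arr F (word_class A S [Orig f]) = on_arr G (word_class A S [Orig f])"
    if "f \<in> Arr A" for f
    using fun_cong[OF arg_cong[OF eq, of on_arr], of f] that
    by (simp add: functor_comp_def localization_functor_def compose_def)
  have inverse: "on_arr H (word_class A S [Formal s]) \<in> Arr B
      \<and> src B (on_arr H (word_class A S [Formal s])) = on_obj H (tgt A s)
      \<and> tgt B (on_arr H (word_class A S [Formal s])) = on_obj H (src A s)
      \<and> cmp B (on_arr H (word_class A S [Formal s])) (on_arr H (word_class A S [Orig s]))
          = ident B (on_obj H (src A s))
      \<and> cmp B (on_arr H (word_class A S [Orig s])) (on_arr H (word_class A S [Formal s]))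
          = ident B (on_obj H (tgt A s))
      \<and> on_arr H (word_class A S [Orig s]) \<in> Arr B
      \<and> src B (on_arr H (word_class A S [Orig s])) = on_obj H (src A s)
      \<and> tgt B (on_arr H (word_class A S [Orig s])) = on_obj H (tgt A s)"
    if H: "is_functor L B H" and s: "s \<in> S" for H s
  proof -
    let ?o = "word_class A S [Orig s]" and ?f = "word_class A S [Formal s]"
    have sA: "s \<in> Arr A" using s S_Arr by blast
    have arr: "?o \<in> Arr L" "?f \<in> Arr L" using s sA by (auto simp: Arr_L)
    have ends: "src L ?o = src A s" "tgt L ?o = tgt A s" "src L ?f = tgt A s" "tgt L ?f = src A s"
      using s sA by (auto simp: src_L tgt_L)
    have "on_arr H (cmp L ?f ?o) = cmp B (on_arr H ?f) (on_arr H ?o)"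
      "on_arr H (cmp L ?o ?f) = cmp B (on_arr H ?o) (on_arr H ?f)"
      using H arr ends by (auto simp: is_functor_def)
    moreover have "on_arr H (ident L X) = ident B (on_obj H X)" if "X \<in> Obj A" for X
      using H that by (auto simp: is_functor_def)
    ultimately show ?thesis
      using H arr ends cmp_L_inverse[OF s] src_Obj[OF sA] tgt_Obj[OF sA]
      by (auto simp: is_functor_def)
  qed
  have formal: "on_arr F (word_class A S [Formal s]) = on_arr G (word_class A S [Formal s])"
    if s: "s \<in> S" for s
  proof -
    have sA: "s \<in> Arr A" using s S_Arr by blast
    \<comment> \<open>\<open>?f\<close> and \<open>?g\<close> are both inverse to \<open>?o\<close>.\<close>
    let ?o = "on_arr F (word_class A S [Orig s])"
    let ?f = "on_arr F (word_class A S [Formal s])" and ?g = "on_arr G (word_class A S [Formal s])"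
    note f = inverse[OF F s] and g = inverse[OF G s, folded orig[OF sA]
        obj[OF src_Obj[OF sA]] obj[OF tgt_Obj[OF sA]]]
    have "?f = cmp B ?f (cmp B ?o ?g)"
      using f g B.ident_right[of ?f] by simp
    also have "\<dots> = cmp B (cmp B ?f ?o) ?g"
      using f g B.cmp_assoc[of ?f ?o ?g] by simp
    also have "\<dots> = ?g"
      using f g B.ident_left[of ?g] by simp
    finally show ?thesis .
  qed
  have letter: "on_arr F (word_class A S [a]) = on_arr G (word_class A S [a])"
    if "a \<in> arrows A S" for a
    using that by (cases a) (auto simp: orig formal)
  have word: "on_arr F (word_class A S w) = on_arr G (word_class A S w)"
    if "w \<in> words A S" for w
  proof -
    have "w \<noteq> []" using that by (rule words_nonempty)
    then show ?thesis using that
    proof (induction w rule: list_nonempty_induct)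
      case (single a)
      then show ?case by (simp add: letter)
    next
      case (cons a w)
      then have a: "a \<in> arrows A S" "w \<in> words A S" "arrow_src A a = word_tgt A w"
        by (auto simp: Cons_words)
      have "on_arr H (word_class A S (a # w))
          = cmp B (on_arr H (word_class A S [a])) (on_arr H (word_class A S w))"
        if "is_functor L B H" for H
      proof -
        have "word_class A S (a # w) = cmp L (word_class A S [a]) (word_class A S w)"
          using a by (simp add: cmp_L)
        moreover have "src L (word_class A S [a]) = tgt L (word_class A S w)"
          using a by (simp add: src_L tgt_L)
        moreover have "word_class A S [a] \<in> Arr L" "word_class A S w \<in> Arr L"
          using a by (auto simp: Arr_L)
        ultimately show ?thesis using that by (simp add: is_functor_def)
      qed
      then show ?case using F G a letter cons.IH by simp
    qed
  qed
  have "on_obj F = on_obj G"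
    using F G obj by (intro PiE_ext[where k = "Obj A" and s = "\<lambda>_. Obj B"])
      (auto simp: is_functor_def)
  moreover have "on_arr F = on_arr G"
    using F G word by (intro PiE_ext[where k = "Arr L" and s = "\<lambda>_. Arr B"])
      (auto simp: is_functor_def Arr_L)
  ultimately show ?thesis by simp
qed

end

section \<open>Zigzags\<close>

text \<open>
  A pair \<open>(f, s)\<close> stands for a roof "\<open>f\<close> after the formal inverse of \<open>s\<close>";
  a zigzag is a formal composite of such roofs.
\<close>

definition zigzag :: "('m \<times> 'm) list \<Rightarrow> 'm arrow list" where
  "zigzag ps = concat (map (\<lambda>(f, s). [Orig f, Formal s]) ps)"

lemma zigzag_simps [simp]:
  "zigzag [] = []" "zigzag ((f, s) # ps) = Orig f # Formal s # zigzag ps"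
  "zigzag (ps @ qs) = zigzag ps @ zigzag qs"
  by (auto simp: zigzag_def)

lemma zigzag_eq_Nil_iff [simp]: "zigzag ps = [] \<longleftrightarrow> ps = []"
  by (cases ps) auto

locale localizing_with_identities = localizing +
  assumes ident_S: "X \<in> Obj A \<Longrightarrow> ident A X \<in> S"
begin

text \<open>
  The word \<open>[Formal (ident A X), Orig (ident A X)]\<close> can be shortened in two ways, by the unit
  law and by the cancellation law.
\<close>

lemma formal_ident_trivial:
  assumes "X \<in> Obj A"
  shows "word_equiv A S [Formal (ident A X)] [Orig (ident A X)]"
proof -
  have s: "ident A X \<in> S" using assms by (rule ident_S)
  have "word_equiv A S [Formal (ident A X), Orig (ident A X)] [Formal (ident A X)]"
    using word_equiv.id_right[of "Formal (ident A X)" A S] s assms by (simp add: tgt_ident)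
  moreover have "word_equiv A S [Formal (ident A X), Orig (ident A X)] [Orig (ident A X)]"
    using word_equiv.inv_left[OF s, of A] assms by (simp add: src_ident)
  ultimately show ?thesis by (blast intro: word_equiv.sym word_equiv.trans)
qed

text \<open>
  The missing half of the pair is filled with an identity, formal or original.
\<close>

lemma letter_zigzag:
  assumes "a \<in> arrows A S"
  shows "\<exists>f s. word_equiv A S [Orig f, Formal s] [a]"
proof (cases a)
  case (Orig f)
  let ?e = "ident A (src A f)"
  have f: "f \<in> Arr A" "src A f \<in> Obj A" using assms Orig by (auto simp: src_Obj)
  then have "word_equiv A S ([Orig f] @ [Formal ?e]) ([Orig f] @ [Orig ?e])"
    by (intro word_equiv_append word_equiv.refl formal_ident_trivial) (auto simp: src_ident)
  moreover have "word_equiv A S [Orig f, Orig ?e] [Orig f]"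
    using word_equiv.id_right[OF assms] Orig by simp
  ultimately show ?thesis using Orig by (auto intro: word_equiv.trans)
next
  case (Formal s)
  then show ?thesis using word_equiv.id_left[OF assms] by auto
qed

lemma word_zigzag:
  assumes "w \<in> words A S"
  shows "\<exists>ps. length ps = length w \<and> word_equiv A S (zigzag ps) w"
proof -
  have "w \<noteq> []" using assms by (rule words_nonempty)
  then show ?thesis using assms
  proof (induction w rule: list_nonempty_induct)
    case (single a)
    then obtain f s where "word_equiv A S [Orig f, Formal s] [a]"
      using letter_zigzag[of a] by auto
    then show ?case by (intro exI[of _ "[(f, s)]"]) simp
  next
    case (cons a w)
    then have a: "a \<in> arrows A S" "w \<in> words A S" "arrow_src A a = word_tgt A w"
      by (auto simp: Cons_words)
    obtain f s where fs: "word_equiv A S [Orig f, Formal s] [a]"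
      using letter_zigzag[of a] a by auto
    obtain ps where ps: "length ps = length w" "word_equiv A S (zigzag ps) w"
      using cons a by auto
    have "word_equiv A S ([Orig f, Formal s] @ zigzag ps) ([a] @ w)"
      using fs ps(2)
    proof (rule word_equiv_append)
      show "word_src A [Orig f, Formal s] = word_tgt A (zigzag ps)"
        using word_equiv_parallel[OF fs] word_equiv_parallel[OF ps(2)] a by simp
    qed
    then show ?case using ps by (intro exI[of _ "(f, s) # ps"]) simp
  qed
qed

text \<open>
  Appending identities to a zigzag lengthens it without changing its class, so all words up to a
  given length have representatives of one common shape.
\<close>

lemma word_zigzag_of_length:
  assumes "w \<in> words A S" "length w \<le> n"
  shows "\<exists>ps. length ps = n \<and> word_equiv A S (zigzag ps) w"
  using assms(2)
proof (induction n rule: dec_induct)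
  case base
  then show ?case using word_zigzag assms by blast
next
  case (step n)
  then obtain ps where ps: "length ps = n" "word_equiv A S (zigzag ps) w" by blast
  let ?X = "word_src A w" and ?e = "ident A (word_src A w)"
  have X: "?X \<in> Obj A" using assms by (simp add: word_src_Obj)
  have e: "word_equiv A S [Orig ?e, Formal ?e] [Orig ?e]"
    using word_equiv.inv_right[OF ident_S[OF X], of A] X by (simp add: tgt_ident)
  have "word_equiv A S (zigzag ps @ [Orig ?e, Formal ?e]) (w @ [Orig ?e])"
    using ps(2) e by (rule word_equiv_append)
      (use word_equiv_parallel[OF ps(2)] X in \<open>simp add: tgt_ident\<close>)
  then have "word_equiv A S (zigzag (ps @ [(?e, ?e)])) w"
    using ident_word_right[OF assms(1)] by (auto intro: word_equiv.trans)
  then show ?case using ps by (intro exI[of _ "ps @ [(?e, ?e)]"]) simp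
qed

end

section \<open>The canonical functor on words\<close>

lemma product_category_simps [simp]:
  "Obj (product_category I A) = (\<Pi>\<^sub>E i\<in>I. Obj (A i))"
  "Arr (product_category I A) = (\<Pi>\<^sub>E i\<in>I. Arr (A i))"
  "src (product_category I A) f = (\<lambda>i\<in>I. src (A i) (f i))"
  "tgt (product_category I A) f = (\<lambda>i\<in>I. tgt (A i) (f i))"
  "ident (product_category I A) X = (\<lambda>i\<in>I. ident (A i) (X i))"
  "cmp (product_category I A) g f = (\<lambda>i\<in>I. cmp (A i) (g i) (f i))"
  by (simp_all add: product_category_def)

lemma restrict_eq_iff: "restrict f I = restrict g I \<longleftrightarrow> (\<forall>i\<in>I. f i = g i)"
  by (auto simp: fun_eq_iff restrict_def)

lemma category_product:
  assumes "\<And>i. i \<in> I \<Longrightarrow> category (A i)"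
  shows "category (product_category I A)"
proof
  let ?P = "product_category I A"
  fix f assume "f \<in> Arr ?P"
  then show "src ?P f \<in> Obj ?P" "tgt ?P f \<in> Obj ?P"
    "cmp ?P (ident ?P (tgt ?P f)) f = f" "cmp ?P f (ident ?P (src ?P f)) = f"
    using assms by (auto simp: category.src_Obj category.tgt_Obj category.ident_left
        category.ident_right PiE_iff intro!: extensionalityI[where A = I])
next
  let ?P = "product_category I A"
  fix X assume "X \<in> Obj ?P"
  then show "ident ?P X \<in> Arr ?P" "src ?P (ident ?P X) = X" "tgt ?P (ident ?P X) = X"
    using assms by (auto simp: category.ident_Arr category.src_ident category.tgt_ident
        PiE_iff intro!: extensionalityI[where A = I])
next
  let ?P = "product_category I A"
  fix g f assume "g \<in> Arr ?P" "f \<in> Arr ?P" "src ?P g = tgt ?P f"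
  then show "cmp ?P g f \<in> Arr ?P" "src ?P (cmp ?P g f) = src ?P f"
    "tgt ?P (cmp ?P g f) = tgt ?P g"
    using assms by (auto simp: restrict_eq_iff category.cmp_Arr category.src_cmp category.tgt_cmp
        PiE_iff)
next
  let ?P = "product_category I A"
  fix h g f
  assume "h \<in> Arr ?P" "g \<in> Arr ?P" "f \<in> Arr ?P" "src ?P h = tgt ?P g" "src ?P g = tgt ?P f"
  then show "cmp ?P (cmp ?P h g) f = cmp ?P h (cmp ?P g f)"
    using assms by (auto simp: restrict_eq_iff category.cmp_assoc PiE_iff)
qed

definition proj :: "'i \<Rightarrow> ('i \<Rightarrow> 'm) arrow list \<Rightarrow> 'm arrow list" where
  "proj i = map (map_arrow (\<lambda>f. f i))"

lemma proj_simps [simp]: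
  "proj i [] = []" "proj i (a # w) = map_arrow (\<lambda>f. f i) a # proj i w"
  "proj i (v @ w) = proj i v @ proj i w" "length (proj i w) = length w"
  "proj i w = [] \<longleftrightarrow> w = []"
  by (auto simp: proj_def)

lemma proj_zigzag: "proj i (zigzag ps) = zigzag (map (\<lambda>(f, s). (f i, s i)) ps)"
  by (induction ps) auto

locale localizing_family =
  fixes I :: "'i set" and A :: "'i \<Rightarrow> ('o, 'm) category" and S :: "'i \<Rightarrow> 'm set"
  assumes localizing: "i \<in> I \<Longrightarrow> localizing (A i) (S i)"
begin

abbreviation P where "P \<equiv> product_category I A"
abbreviation SP where "SP \<equiv> Pi\<^sub>E I S"
abbreviation T where "T \<equiv> product_category I (\<lambda>i. localization (A i) (S i))"

sublocale P: localizing P SP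
proof -
  interpret category P
    by (rule category_product) (use localizing in \<open>auto simp: localizing_def\<close>)
  show "localizing P SP"
  proof
    have "S i \<subseteq> Arr (A i)" if "i \<in> I" for i
      using localizing[OF that] by (rule localizing.S_Arr)
    then show "SP \<subseteq> Arr P" by (auto simp: PiE_iff)
  qed
qed

sublocale T: category T
  by (rule category_product) (rule localizing.category_L[OF localizing])

lemma arrow_src_proj: "i \<in> I \<Longrightarrow> arrow_src (A i) (map_arrow (\<lambda>f. f i) a) = arrow_src P a i"
  and arrow_tgt_proj: "i \<in> I \<Longrightarrow> arrow_tgt (A i) (map_arrow (\<lambda>f. f i) a) = arrow_tgt P a i"
  by (cases a; simp)+

lemma word_src_proj: "i \<in> I \<Longrightarrow> w \<noteq> [] \<Longrightarrow> word_src (A i) (proj i w) = word_src P w i"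
  and word_tgt_proj: "i \<in> I \<Longrightarrow> w \<noteq> [] \<Longrightarrow> word_tgt (A i) (proj i w) = word_tgt P w i"
  by (simp_all add: word_src_def word_tgt_def proj_def last_map hd_map arrow_src_proj arrow_tgt_proj)

lemma proj_arrow:
  assumes "i \<in> I" "a \<in> arrows P SP"
  shows "map_arrow (\<lambda>f. f i) a \<in> arrows (A i) (S i)"
  using assms by (auto simp: arrows_def PiE_mem)

lemma proj_words:
  assumes i: "i \<in> I" and w: "w \<in> words P SP"
  shows "proj i w \<in> words (A i) (S i)"
proof -
  have "successively (\<lambda>b a. arrow_src (A i) (map_arrow (\<lambda>f. f i) b)
      = arrow_tgt (A i) (map_arrow (\<lambda>f. f i) a)) w"
    using w i by (auto simp: words_def arrow_src_proj arrow_tgt_proj elim: successively_mono)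
  with assms show ?thesis
    by (auto simp: words_def proj_def successively_map proj_arrow subset_iff)
qed

text \<open>
  Each generating relation over the product consists of one instance of the same relation in every
  factor.
\<close>

lemma proj_word_equiv:
  assumes i: "i \<in> I" and vw: "word_equiv P SP v w"
  shows "word_equiv (A i) (S i) (proj i v) (proj i w)"
  using vw
proof induction
  case (comp g f)
  have "src (A i) (g i) = tgt (A i) (f i)"
    using comp i by (auto simp: restrict_eq_iff)
  then show ?case using comp i by (auto simp: PiE_mem intro!: word_equiv.comp)
next
  case (id_left a)
  then show ?case
    using word_equiv.id_left[OF proj_arrow[OF i id_left]] i by (simp add: arrow_tgt_proj)
next
  case (id_right a)
  then show ?case
    using word_equiv.id_right[OF proj_arrow[OF i id_right]] i by (simp add: arrow_src_proj)
next
  case (inv_right s)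
  then show ?case using i by (auto simp: PiE_mem intro!: word_equiv.inv_right)
next
  case (inv_left s)
  then show ?case using i by (auto simp: PiE_mem intro!: word_equiv.inv_left)
next
  case (refl w)
  then show ?case by (intro word_equiv.refl proj_words i)
next
  case (sym v w)
  then show ?case by (blast intro: word_equiv.sym)
next
  case (trans u v w)
  then show ?case by (blast intro: word_equiv.trans)
next
  case (cong_left v w u)
  then show ?case using i P.word_equiv_parallel[OF cong_left.hyps(1)]
    by (auto intro!: word_equiv.cong_left simp: proj_words word_src_proj word_tgt_proj P.words_nonempty)
next
  case (cong_right v w u)
  then show ?case using i P.word_equiv_parallel[OF cong_right.hyps(1)]
    by (auto intro!: word_equiv.cong_right simp: proj_words word_src_proj word_tgt_proj P.words_nonempty)
qed

text \<open>
  Membership in a product and equality of endpoints are tested componentwise, once the letters are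
  known to be families indexed by \<open>I\<close> only. The condition \<open>w \<noteq> []\<close> has to be
  stated because it cannot be read off the projections when \<open>I\<close> is empty.
\<close>

lemma words_if_proj_words:
  assumes "w \<noteq> []" and ext: "\<And>a. a \<in> set w \<Longrightarrow> set_arrow a \<subseteq> extensional I"
    and proj: "\<And>i. i \<in> I \<Longrightarrow> proj i w \<in> words (A i) (S i)"
  shows "w \<in> words P SP"
proof -
  have "a \<in> arrows P SP" if a: "a \<in> set w" for a
  proof -
    have "map_arrow (\<lambda>f. f i) a \<in> arrows (A i) (S i)" if "i \<in> I" for i
      using proj[OF that] a by (auto simp: words_def proj_def)
    with ext[OF a] show ?thesis
      by (cases a) (auto simp: arrows_def PiE_iff image_iff)
  qed
  moreover have "successively (\<lambda>b a. arrow_src P b = arrow_tgt P a) w"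
    unfolding successively_conv_nth
  proof (intro allI impI)
    fix k assume k: "Suc k < length w"
    have eq: "arrow_src P (w ! k) i = arrow_tgt P (w ! Suc k) i" if i: "i \<in> I" for i
      using proj[OF i] k i
      by (auto simp: words_def proj_def successively_conv_nth arrow_src_proj arrow_tgt_proj)
    have "arrow_src P b \<in> extensional I" "arrow_tgt P b \<in> extensional I" for b
      by (cases b; simp)+
    with eq show "arrow_src P (w ! k) = arrow_tgt P (w ! Suc k)"
      by (blast intro: extensionalityI)
  qed
  ultimately show ?thesis using assms(1) by (auto simp: words_def)
qed

text \<open>
  All members of the union over \<open>w \<in> c\<close> coincide, so the union selects their common value
  without a choice of a representative.
\<close>

definition componentwise ::
  "('i \<Rightarrow> 'o, ('i \<Rightarrow> 'm) arrow list set, 'i \<Rightarrow> 'o, 'i \<Rightarrow> 'm arrow list set) functor_data" where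
  "componentwise = \<lparr>
    on_obj = (\<lambda>X\<in>Obj P. X),
    on_arr = (\<lambda>c\<in>Arr P.L. \<lambda>i\<in>I. \<Union>w\<in>c. word_class (A i) (S i) (proj i w))\<rparr>"

lemma on_obj_componentwise: "X \<in> Obj P \<Longrightarrow> on_obj componentwise X = X"
  by (simp add: componentwise_def)

lemma on_arr_componentwise:
  assumes w: "w \<in> words P SP"
  shows "on_arr componentwise (word_class P SP w) = (\<lambda>i\<in>I. word_class (A i) (S i) (proj i w))"
proof -
  have "(\<Union>v\<in>word_class P SP w. word_class (A i) (S i) (proj i v)) = word_class (A i) (S i) (proj i w)"
    if i: "i \<in> I" for i
  proof -
    have "word_class (A i) (S i) (proj i v) = word_class (A i) (S i) (proj i w)"
      if "v \<in> word_class P SP w" for v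
      using that localizing.word_class_eq_iff[OF localizing[OF i] proj_words[OF i w]]
        proj_word_equiv[OF i] P.mem_word_class by metis
    moreover have "w \<in> word_class P SP w"
      using w by (simp add: P.mem_word_class word_equiv.refl)
    ultimately show ?thesis by blast
  qed
  then show ?thesis using w by (simp add: componentwise_def P.Arr_L restrict_eq_iff)
qed

lemma componentwise_functor: "is_functor P.L T componentwise"
  unfolding is_functor_def
proof (intro conjI ballI impI)
  show "on_obj componentwise \<in> Obj P.L \<rightarrow>\<^sub>E Obj T"
    by (auto simp: componentwise_def localizing.Obj_L[OF localizing] PiE_iff)
  have arr: "(\<lambda>i\<in>I. word_class (A i) (S i) (proj i w)) \<in> Arr T" if "w \<in> words P SP" for w
    using that by (auto simp: localizing.Arr_L[OF localizing] proj_words)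
  show "on_arr componentwise \<in> Arr P.L \<rightarrow>\<^sub>E Arr T"
  proof (rule PiE_I)
    fix c assume "c \<in> Arr P.L"
    then show "on_arr componentwise c \<in> Arr T"
      using arr by (auto simp: P.Arr_L on_arr_componentwise simp del: product_category_simps)
  qed (simp add: componentwise_def)
next
  fix f assume "f \<in> Arr P.L"
  then obtain w where w: "f = word_class P SP w" "w \<in> words P SP" by (auto simp: P.Arr_L)
  have "word_src P w \<in> extensional I" "word_tgt P w \<in> extensional I"
    using P.word_src_Obj[OF w(2)] P.word_tgt_Obj[OF w(2)] by (auto simp: PiE_iff)
  moreover have "word_src (A i) (proj i w) = word_src P w i" "word_tgt (A i) (proj i w) = word_tgt P w i"
    if "i \<in> I" for i
    using that w by (auto simp: word_src_proj word_tgt_proj P.words_nonempty)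
  ultimately show "src T (on_arr componentwise f) = on_obj componentwise (src P.L f)"
    "tgt T (on_arr componentwise f) = on_obj componentwise (tgt P.L f)"
    using w P.word_src_Obj[OF w(2)] P.word_tgt_Obj[OF w(2)]
    by (auto simp: on_arr_componentwise on_obj_componentwise P.src_L P.tgt_L
        localizing.src_L[OF localizing] localizing.tgt_L[OF localizing] proj_words
        intro!: extensionalityI[where A = I] simp del: product_category_simps(1))
next
  fix X assume "X \<in> Obj P.L"
  then have X: "X \<in> Obj P" by simp
  then have "[Orig (ident P X)] \<in> words P SP"
    using P.ident_Arr[OF X] by simp
  then show "on_arr componentwise (ident P.L X) = ident T (on_obj componentwise X)"
    unfolding P.ident_L on_arr_componentwise[OF \<open>[Orig (ident P X)] \<in> words P SP\<close>]
      on_obj_componentwise[OF X]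
    by (auto simp: restrict_eq_iff localizing.ident_L[OF localizing])
next
  fix g f assume "g \<in> Arr P.L" "f \<in> Arr P.L" "src P.L g = tgt P.L f"
  then obtain v w where vw: "g = word_class P SP v" "f = word_class P SP w"
    "v \<in> words P SP" "w \<in> words P SP" "word_src P v = word_tgt P w"
    by (auto simp: P.Arr_L P.src_L P.tgt_L)
  then show "on_arr componentwise (cmp P.L g f) =
      cmp T (on_arr componentwise g) (on_arr componentwise f)"
    by (auto simp: restrict_eq_iff P.cmp_L on_arr_componentwise P.append_words
        localizing.cmp_L[OF localizing] proj_words word_src_proj word_tgt_proj P.words_nonempty)
qed

lemma componentwise_comp:
  "functor_comp P componentwise (localization_functor P SP) =
    product_functor I A (\<lambda>i. localization_functor (A i) (S i))"
proof -
  have "on_obj componentwise X = (\<lambda>i\<in>I. on_obj (localization_functor (A i) (S i)) (X i))"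
    if "X \<in> Obj P" for X
    using that by (auto simp: on_obj_componentwise localization_functor_def PiE_mem
        intro!: extensionalityI[where A = I] simp del: product_category_simps(1)) 
      (auto simp: PiE_iff)
  moreover have "on_arr componentwise (word_class P SP [Orig f]) =
      (\<lambda>i\<in>I. on_arr (localization_functor (A i) (S i)) (f i))" if "f \<in> Arr P" for f
  proof -
    have "[Orig f] \<in> words P SP" using that by (simp del: product_category_simps)
    then show ?thesis
      using that by (auto simp: on_arr_componentwise restrict_eq_iff localization_functor_def PiE_mem)
  qed
  ultimately show ?thesis
    by (auto simp: functor_comp_def product_functor_def compose_def localization_functor_def
        simp del: product_category_simps intro!: restrict_ext)
qed

lemma canonical_functor_componentwise: "canonical_functor I A S = componentwise"
  unfolding canonical_functor_def
proof (rule the_equality)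
  show "is_functor P.L T componentwise \<and>
    functor_comp P componentwise (localization_functor P SP) =
    product_functor I A (\<lambda>i. localization_functor (A i) (S i))"
    using componentwise_functor componentwise_comp by blast
next
  fix \<Theta>
  assume "is_functor P.L T \<Theta> \<and> functor_comp P \<Theta> (localization_functor P SP) =
    product_functor I A (\<lambda>i. localization_functor (A i) (S i))"
  then show "\<Theta> = componentwise"
    using componentwise_functor componentwise_comp
    by (auto intro: P.functor_from_localization_unique[OF T.category_axioms])
qed

text \<open>
  Passing to representatives turns fullness into a statement about words. An arrow of the
  target is a family of classes, and its endpoints are those of any family of representatives; the
  functor is the identity on objects, so the class of a lift automatically has the prescribed
  endpoints.
\<close>

lemma full_iff_lift_words:
  "full_functor P.L T (canonical_functor I A S) \<longleftrightarrow>
    (\<forall>w. (\<forall>i\<in>I. w i \<in> words (A i) (S i)) \<longrightarrow>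
      (\<exists>v\<in>words P SP. \<forall>i\<in>I. word_equiv (A i) (S i) (proj i v) (w i)))"
  (is "?full \<longleftrightarrow> ?lift")
proof
  assume ?full
  show ?lift
  proof (intro allI impI)
    fix w assume w: "\<forall>i\<in>I. w i \<in> words (A i) (S i)"
    let ?X = "\<lambda>i\<in>I. word_src (A i) (w i)" and ?Y = "\<lambda>i\<in>I. word_tgt (A i) (w i)"
    let ?g = "\<lambda>i\<in>I. word_class (A i) (S i) (w i)"
    have XY: "?X \<in> Obj P" "?Y \<in> Obj P"
      using w by (auto simp: localizing.word_src_Obj[OF localizing] localizing.word_tgt_Obj[OF localizing])
    have g: "?g \<in> Arr T" using w by (auto simp: localizing.Arr_L[OF localizing])
    have ends: "src T ?g = ?X" "tgt T ?g = ?Y"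
      using w by (auto simp: restrict_eq_iff localizing.src_L[OF localizing] localizing.tgt_L[OF localizing])
    have "\<exists>f\<in>Arr P.L. src P.L f = ?X \<and> tgt P.L f = ?Y \<and> on_arr componentwise f = ?g"
      using \<open>?full\<close>[unfolded full_functor_def canonical_functor_componentwise P.Obj_L,
          rule_format, OF XY g]
      unfolding on_obj_componentwise[OF XY(1)] on_obj_componentwise[OF XY(2)] ends by simp
    then obtain f where "f \<in> Arr P.L" "on_arr componentwise f = ?g" by blast
    then obtain v where v: "v \<in> words P SP" "on_arr componentwise (word_class P SP v) = ?g"
      by (auto simp: P.Arr_L)
    then have "word_class (A i) (S i) (proj i v) = word_class (A i) (S i) (w i)" if "i \<in> I" for i
      using that by (auto simp: on_arr_componentwise restrict_eq_iff)
    then show "\<exists>v\<in>words P SP. \<forall>i\<in>I. word_equiv (A i) (S i) (proj i v) (w i)"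
      using v(1) proj_words localizing.word_class_eq_iff[OF localizing] by blast
  qed
next
  assume ?lift
  show ?full
    unfolding full_functor_def canonical_functor_componentwise P.Obj_L
  proof (intro ballI impI)
    fix X Y g
    assume X: "X \<in> Obj P" and Y: "Y \<in> Obj P" and g: "g \<in> Arr T"
      and "src T g = on_obj componentwise X \<and> tgt T g = on_obj componentwise Y"
    then have ends: "X = src T g" "Y = tgt T g"
      by (simp_all add: on_obj_componentwise del: product_category_simps)
    have "\<forall>i\<in>I. \<exists>w. w \<in> words (A i) (S i) \<and> g i = word_class (A i) (S i) w"
      using g localizing.Arr_L[OF localizing] by (fastforce simp: PiE_iff)
    then obtain w where w: "\<forall>i\<in>I. w i \<in> words (A i) (S i) \<and> g i = word_class (A i) (S i) (w i)"
      by metis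
    then obtain v where v: "v \<in> words P SP"
      "\<forall>i\<in>I. word_equiv (A i) (S i) (proj i v) (w i)"
      using \<open>?lift\<close> by metis
    have "on_arr componentwise (word_class P SP v) = (\<lambda>i\<in>I. g i)"
      using v w localizing.word_class_eq_iff[OF localizing] proj_words[OF _ v(1)]
      by (auto simp: on_arr_componentwise restrict_eq_iff)
    then have map: "on_arr componentwise (word_class P SP v) = g"
      using g by (auto simp: PiE_iff extensional_restrict)
    have c: "word_class P SP v \<in> Arr P.L" using v by (auto simp: P.Arr_L)
    have "src P.L (word_class P SP v) \<in> Obj P" "tgt P.L (word_class P SP v) \<in> Obj P"
      using v P.word_src_Obj P.word_tgt_Obj by (simp_all add: P.src_L P.tgt_L del: product_category_simps)
    moreover have "src T g = on_obj componentwise (src P.L (word_class P SP v))"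
      "tgt T g = on_obj componentwise (tgt P.L (word_class P SP v))"
      using componentwise_functor c unfolding is_functor_def map[symmetric] by blast+
    ultimately have "src P.L (word_class P SP v) = X" "tgt P.L (word_class P SP v) = Y"
      unfolding ends by (simp_all add: on_obj_componentwise del: product_category_simps)
    with c map show "\<exists>f\<in>Arr P.L. src P.L f = X \<and> tgt P.L f = Y \<and> on_arr componentwise f = g"
      by blast
  qed
qed

end

section \<open>Fullness and bounded word lengths\<close>

text \<open>
  Greedy choice: at each step only finitely many elements have been used, so the next infinite set
  contains a fresh one. The state of the recursion is the current element together with the finite
  set of all elements chosen so far.
\<close>

lemma inj_choice_from_infinite_sets:
  fixes B :: "nat \<Rightarrow> 'a set"
  assumes "\<And>n. infinite (B n)"
  shows "\<exists>f. inj f \<and> (\<forall>n. f n \<in> B n)"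
proof -
  have avoid: "\<exists>x. x \<in> B n \<and> x \<notin> F" if "finite F" for n F
    using assms[of n] that by (meson finite_subset subsetI)
  have "\<exists>p. \<forall>n. (finite (snd (p n)) \<and> fst (p n) \<in> B n \<and> fst (p n) \<in> snd (p n)) \<and>
      (snd (p n) \<subseteq> snd (p (Suc n)) \<and> fst (p (Suc n)) \<notin> snd (p n))"
  proof (rule dependent_nat_choice)
    obtain x where "x \<in> B 0" using avoid[of "{}"] by auto
    then show "\<exists>q. finite (snd q) \<and> fst q \<in> B 0 \<and> fst q \<in> snd q"
      by (intro exI[of _ "(x, {x})"]) simp
  next
    fix q :: "'a \<times> 'a set" and n
    assume q: "finite (snd q) \<and> fst q \<in> B n \<and> fst q \<in> snd q"
    then obtain x where "x \<in> B (Suc n)" "x \<notin> snd q" using avoid by blast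
    with q show "\<exists>r. (finite (snd r) \<and> fst r \<in> B (Suc n) \<and> fst r \<in> snd r) \<and>
        (snd q \<subseteq> snd r \<and> fst r \<notin> snd q)"
      by (intro exI[of _ "(x, insert x (snd q))"]) auto
  qed
  then obtain p where p: "\<And>n. fst (p n) \<in> B n" "\<And>n. fst (p n) \<in> snd (p n)"
    "\<And>n. snd (p n) \<subseteq> snd (p (Suc n))" "\<And>n. fst (p (Suc n)) \<notin> snd (p n)"
    by blast
  have "fst (p m) \<noteq> fst (p n)" if mn: "m < n" for m n
  proof -
    obtain k where k: "n = Suc k" "m \<le> k" using mn by (auto elim: lessE)
    have "snd (p m) \<subseteq> snd (p k)" using p(3) k(2) by (rule lift_Suc_mono_le)
    then show ?thesis using p(2)[of m] p(4)[of k] k by auto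
  qed
  then have "inj (\<lambda>n. fst (p n))" by (intro linorder_injI) auto
  then show ?thesis using p(1) by blast
qed

context localizing_family
begin

text \<open>
  The letters of a single lift serve all factors at once, so its length \<open>n\<close> contradicts the
  word placed at the \<open>n\<close>-th of the chosen factors.
\<close>

lemma lengths_bounded_if_lift_words:
  assumes ne: "\<And>i. i \<in> I \<Longrightarrow> Obj (A i) \<noteq> {}"
    and lift: "\<And>w. (\<And>i. i \<in> I \<Longrightarrow> w i \<in> words (A i) (S i)) \<Longrightarrow>
      \<exists>v\<in>words P SP. \<forall>i\<in>I. word_equiv (A i) (S i) (proj i v) (w i)"
  shows "\<exists>N. finite {i \<in> I. \<exists>w\<in>words (A i) (S i). N < word_length (A i) (S i) w}"
proof (rule ccontr)
  let ?B = "\<lambda>n. {i \<in> I. \<exists>w\<in>words (A i) (S i). n < word_length (A i) (S i) w}"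
  assume "\<not> ?thesis"
  then obtain \<iota> where \<iota>: "inj \<iota>" "\<And>n. \<iota> n \<in> ?B n"
    using inj_choice_from_infinite_sets[of ?B] by blast
  then obtain u where u: "\<And>n. u n \<in> words (A (\<iota> n)) (S (\<iota> n))"
    "\<And>n. n < word_length (A (\<iota> n)) (S (\<iota> n)) (u n)"
    by simp metis
  have "\<exists>w. w \<in> words (A i) (S i)" if i: "i \<in> I" for i
  proof -
    interpret localizing "A i" "S i" using i by (rule localizing)
    obtain X where "X \<in> Obj (A i)" using ne[OF i] by blast
    then have "[Orig (ident (A i) X)] \<in> words (A i) (S i)" by (simp add: ident_Arr)
    then show ?thesis ..
  qed
  then obtain e where e: "\<And>i. i \<in> I \<Longrightarrow> e i \<in> words (A i) (S i)" by metis
  \<comment> \<open>At the indices outside \<open>range \<iota>\<close> any word will do; nonempty categories have one.\<close>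
  define w where "w i = (if i \<in> range \<iota> then u (inv \<iota> i) else e i)" for i
  have w_\<iota>: "w (\<iota> n) = u n" for n using \<iota>(1) by (simp add: w_def)
  have "w i \<in> words (A i) (S i)" if "i \<in> I" for i
    using u(1) e[OF that] \<iota>(1) by (auto simp: w_def)
  then obtain v where v: "\<And>i. i \<in> I \<Longrightarrow> word_equiv (A i) (S i) (proj i v) (w i)"
    using lift by blast
  define n where "n = length v"
  have I: "\<iota> n \<in> I" using \<iota>(2) by blast
  have "word_length (A (\<iota> n)) (S (\<iota> n)) (u n) \<le> n"
    using localizing.word_length_le[OF localizing[OF I] v[OF I]] by (simp add: w_\<iota> n_def)
  with u(2)[of n] show False by simp
qed

end

locale localizing_family_with_identities = localizing_family +
  assumes ident_S: "i \<in> I \<Longrightarrow> X \<in> Obj (A i) \<Longrightarrow> ident (A i) X \<in> S i"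
begin

lemma with_identities: "i \<in> I \<Longrightarrow> localizing_with_identities (A i) (S i)"
  using localizing ident_S
  by (simp add: localizing_with_identities_def localizing_with_identities_axioms_def)

text \<open>
  Normalising all words to zigzags with the same number of roofs makes the kinds of the letters agree
  at every position, so that the \<open>k\<close>-th letters form a letter over the product.
\<close>

lemma lift_words_of_bounded_length:
  assumes w: "\<And>i. i \<in> I \<Longrightarrow> w i \<in> words (A i) (S i) \<and> word_length (A i) (S i) (w i) \<le> n"
  shows "\<exists>v\<in>words P SP. \<forall>i\<in>I. word_equiv (A i) (S i) (proj i v) (w i)"
proof -
  \<comment> \<open>A zigzag of length \<open>Suc n\<close> is nonempty also if \<open>n = 0\<close>, which is possible when
    \<open>I\<close> is empty; then the lift still has to be a nonempty word.\<close>
  have "\<exists>ps. length ps = Suc n \<and> word_equiv (A i) (S i) (zigzag ps) (w i)" if i: "i \<in> I" for i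
  proof -
    interpret localizing_with_identities "A i" "S i" using i by (rule with_identities)
    obtain u where u: "word_equiv (A i) (S i) u (w i)" "length u = word_length (A i) (S i) (w i)"
      using ex_word_of_word_length w[OF i] by blast
    then obtain ps where "length ps = Suc n" "word_equiv (A i) (S i) (zigzag ps) u"
      using word_zigzag_of_length[of u "Suc n"] word_equiv_parallel w[OF i]
      by (metis le_SucI)
    with u show ?thesis by (blast intro: word_equiv.trans)
  qed
  then obtain ps where ps: "\<And>i. i \<in> I \<Longrightarrow> length (ps i) = Suc n"
    "\<And>i. i \<in> I \<Longrightarrow> word_equiv (A i) (S i) (zigzag (ps i)) (w i)"
    by metis
  define qs where "qs = map (\<lambda>k. (\<lambda>i\<in>I. fst (ps i ! k), \<lambda>i\<in>I. snd (ps i ! k))) [0..<Suc n]"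
  have "map (\<lambda>(f, s). (f i, s i)) qs = ps i" if "i \<in> I" for i
    using that by (intro nth_equalityI) (auto simp: qs_def ps nth_append less_Suc_eq simp del: upt_Suc)
  then have proj: "proj i (zigzag qs) = zigzag (ps i)" if "i \<in> I" for i
    using that by (simp add: proj_zigzag)
  have "zigzag qs \<in> words P SP"
  proof (rule words_if_proj_words)
    show "zigzag qs \<noteq> []" by (simp add: qs_def)
    show "set_arrow a \<subseteq> extensional I" if "a \<in> set (zigzag qs)" for a
      using that by (auto simp: qs_def zigzag_def simp del: upt_Suc)
    show "proj i (zigzag qs) \<in> words (A i) (S i)" if "i \<in> I" for i
      using proj[OF that] localizing.word_equiv_parallel[OF localizing[OF that] ps(2)[OF that]] by simp
  qed
  then show ?thesis using proj ps(2) by (intro bexI[of _ "zigzag qs"]) auto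
qed

text \<open>
  Over the finitely many exceptional indices, the lengths of the given words \<open>w i\<close> are bounded
  by their sum.
\<close>

lemma lift_words_if_lengths_bounded:
  assumes "finite F" and N: "\<And>i u. i \<in> I - F \<Longrightarrow> u \<in> words (A i) (S i) \<Longrightarrow> word_length (A i) (S i) u \<le> N"
    and w: "\<And>i. i \<in> I \<Longrightarrow> w i \<in> words (A i) (S i)"
  shows "\<exists>v\<in>words P SP. \<forall>i\<in>I. word_equiv (A i) (S i) (proj i v) (w i)"
proof (rule lift_words_of_bounded_length)
  fix i assume i: "i \<in> I"
  let ?l = "\<lambda>i. word_length (A i) (S i) (w i)"
  have "?l i \<le> N + sum ?l F"
  proof (cases "i \<in> F")
    case True
    then show ?thesis using member_le_sum[of i F ?l] assms(1) by simp
  next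
    case False
    then show ?thesis using N[of i "w i"] i w by fastforce
  qed
  with i w show "w i \<in> words (A i) (S i) \<and> ?l i \<le> N + sum ?l F" by blast
qed

end

theorem theorem5p1:
  fixes I :: "'i set"
    and A :: "'i \<Rightarrow> ('o, 'm) category"
    and S :: "'i \<Rightarrow> 'm set"
  assumes "\<And>i. i \<in> I \<Longrightarrow> category (A i)"
    and "\<And>i. i \<in> I \<Longrightarrow> Obj (A i) \<noteq> {}"
    and "\<And>i. i \<in> I \<Longrightarrow> S i \<subseteq> Arr (A i)"
    and "\<And>i X. i \<in> I \<Longrightarrow> X \<in> Obj (A i) \<Longrightarrow> ident (A i) X \<in> S i"
  shows "full_functor (localization (product_category I A) (Pi\<^sub>E I S))
      (product_category I (\<lambda>i. localization (A i) (S i))) (canonical_functor I A S)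
    \<longleftrightarrow> (\<exists>F. \<exists>N::nat. F \<subseteq> I \<and> finite F \<and>
      (\<forall>i\<in>I - F. \<forall>w\<in>words (A i) (S i). word_length (A i) (S i) w \<le> N))"
    (is "?full \<longleftrightarrow> ?bounded")
proof -
  interpret localizing_family_with_identities I A S
    by (intro localizing_family_with_identities.intro localizing_family.intro
        localizing_family_with_identities_axioms.intro localizing.intro localizing_axioms.intro
        assms)
  show ?thesis
  proof
    assume ?full
    then obtain N where "finite {i \<in> I. \<exists>w\<in>words (A i) (S i). N < word_length (A i) (S i) w}"
      using lengths_bounded_if_lift_words[OF assms(2)] unfolding full_iff_lift_words by blast
    then show ?bounded
      by (intro exI[of _ "{i \<in> I. \<exists>w\<in>words (A i) (S i). N < word_length (A i) (S i) w}"] exI[of _ N])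
        (auto simp: not_less)
  next
    assume ?bounded
    then obtain F N where FN: "finite F"
      "\<And>i u. i \<in> I - F \<Longrightarrow> u \<in> words (A i) (S i) \<Longrightarrow> word_length (A i) (S i) u \<le> N"
      by blast
    then show ?full
      unfolding full_iff_lift_words using lift_words_if_lengths_bounded[OF FN] by blast
  qed
qed

end
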